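(* Let $V$ and $W$ be closed plane $n$-gons in the discrete bicycle correspondence with $|V_iW_i|=2\ell$ for all $i$, i.e. $\mathcal{B}_{2\ell}(V,W)$. The eigenvalue (i.e. the derivative) of the monodromy map $M_{V,2\ell}:S^1\to S^1$ at its fixed point corresponding to $W$ equals $$\prod_{i=1}^n\frac{|V_{i-1}W_i|}{|V_iW_{i-1}|}=\prod_{j}\frac{|\ell+r_j|}{|\ell-r_j|},$$ where $j$ runs over the $n$ half-integers $\tfrac12,\tfrac32,\dots,n-\tfrac12$. In particular, the monodromy is parabolic if and only if $$\prod_{i=1}^n|V_{i-1}W_i|=\prod_{i=1}^n|V_iW_{i-1}|\quad\text{or, equivalently,}\quad\prod_{j}|\ell+r_j|=\prod_{j}|\ell-r_j|.$$
   Context: A closed $n$-gon in $\mathbb{R}^2$ is a sequence of points $V_i$ with $V_{i+n}=V_i$. Discrete bicycle transport. Let $P,Q\in\mathbb{R}^2$, $L>0$, $L\ne|PQ|$, and let $X$ be a point with $|PX|=L$. Translate $X$ along $\overrightarrow{PQ}$ to $U=X+Q-P$ and reflect $U$ in the line $XQ$ to obtain $Y$, the transport of $X$ along $PQ$; then $|QY|=L$. In terms of $u=(X-P)/L$ and $v=(Y-Q)/L$: $v=\frac{2\,u\cdot\xi}{|\xi|^2}\xi-u$ with $\xi=(Q-P)-Lu$. This defines $m_{PQ,L}:S^1\to S^1$, $u\mapsto v$. The monodromy is $M_{V,L}=m_{V_nV_1,L}\circ\dots\circ m_{V_1V_2,L}$, a fractional-linear transformation of $S^1\cong\mathbb{RP}^1$.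 $\mathcal{B}_L(V,W)$ means that for all $i$, $|V_iW_i|=L$ and $W_{i+1}$ is the transport of $W_i$ along $V_iV_{i+1}$; the corresponding fixed point of $M_{V,L}$ is $(W_1-V_1)/L$. Standing conventions: here $L=2\ell$ differs from all side lengths of $V$, and the monodromy is represented by an element of $SL(2,\mathbb{R})$ (i.e. it preserves orientation of $S^1$; equivalently, the number of sides of $V$ longer than $2\ell$ is even). The eigenvalues (derivatives) at its two fixed points are reciprocal to each other, and parabolic means that these two reciprocal eigenvalues coincide, i.e. the representative in $SL(2,\mathbb{R})$ has trace $\pm2$. The signed radii $r_j$: let $Q_i$ be the midpoint of $V_iW_i$, let $e_i$ be the unit vector from $V_i$ to $W_i$, and let $P_{i+\frac12}$ be the intersection point of the lines $V_iW_i$ and $V_{i+1}W_{i+1}$ (assumed to meet in a single point in the formulas involving $r_j$). The number $r_{i+\frac12}$ is defined by $P_{i+\frac12}=Q_i+r_{i+\frac12}e_i$; one also has $P_{i+\frac12}=Q_{i+1}-r_{i+\frac12}e_{i+1}$. (Thus the circles centered at $P_j$ with radii $|r_j|$ form a cyclic chain of consecutively tangent circles with tangency points $Q_i$.) Indices are cyclic. *)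

theory Defs
  imports "HOL-Analysis.Analysis"
begin

text \<open>
  The Euclidean plane is the type \<^typ>\<open>complex\<close>, with its real inner product; the unit circle
  is \<open>sphere 0 1\<close>. Vertices are indexed by \<^typ>\<open>int\<close>, so that indices are cyclic.
\<close>

definition closed_polygon :: "nat \<Rightarrow> (int \<Rightarrow> complex) \<Rightarrow> bool" where
  "closed_polygon n V \<longleftrightarrow> (\<forall>i. V (i + int n) = V i)"

definition reflect_in_line :: "complex \<Rightarrow> complex \<Rightarrow> complex \<Rightarrow> complex" where
  "reflect_in_line a b x =
     a + (2 * ((x - a) \<bullet> (b - a)) / (norm (b - a))\<^sup>2) *\<^sub>R (b - a) - (x - a)"

definition transport :: "complex \<Rightarrow> complex \<Rightarrow> complex \<Rightarrow> complex" where
  "transport P Q X = reflect_in_line X Q (X + Q - P)"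

definition transport_dir :: "complex \<Rightarrow> complex \<Rightarrow> real \<Rightarrow> complex \<Rightarrow> complex" where
  "transport_dir P Q L u =
     (let \<xi> = (Q - P) - L *\<^sub>R u in (2 * (u \<bullet> \<xi>) / (norm \<xi>)\<^sup>2) *\<^sub>R \<xi> - u)"

lemma transport_eq_transport_dir:
  assumes "Q \<noteq> P + L *\<^sub>R u"
  shows "transport P Q (P + L *\<^sub>R u) = Q + L *\<^sub>R transport_dir P Q L u"
proof -
  define \<xi> where "\<xi> = (Q - P) - L *\<^sub>R u"
  have ne: "\<xi> \<bullet> \<xi> \<noteq> 0" using assms by (simp add: \<xi>_def diff_diff_eq)
  have Q: "Q = P + L *\<^sub>R u + \<xi>" by (simp add: \<xi>_def)
  have "transport P Q (P + L *\<^sub>R u) =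
      P + L *\<^sub>R u + (2 * ((\<xi> + L *\<^sub>R u) \<bullet> \<xi>) / (\<xi> \<bullet> \<xi>)) *\<^sub>R \<xi> - (\<xi> + L *\<^sub>R u)"
  proof -
    have "P + L *\<^sub>R u + Q - P - (P + L *\<^sub>R u) = \<xi> + L *\<^sub>R u" "Q - (P + L *\<^sub>R u) = \<xi>"
      by (simp_all add: Q)
    then show ?thesis
      by (simp only: transport_def reflect_in_line_def power2_norm_eq_inner)
  qed
  also have "2 * ((\<xi> + L *\<^sub>R u) \<bullet> \<xi>) / (\<xi> \<bullet> \<xi>) = 2 + L * (2 * (u \<bullet> \<xi>) / (\<xi> \<bullet> \<xi>))"
    proof -
    have "2 * (a + L * b) / a = 2 + L * (2 * b / a)" if "a \<noteq> 0" for a b :: real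
      using that by (simp add: field_simps)
    from this[OF ne] show ?thesis by (simp only: inner_add_left inner_scaleR_left)
  qed
  also have "P + L *\<^sub>R u + (2 + L * (2 * (u \<bullet> \<xi>) / (\<xi> \<bullet> \<xi>))) *\<^sub>R \<xi> - (\<xi> + L *\<^sub>R u)
      = Q + L *\<^sub>R ((2 * (u \<bullet> \<xi>) / (\<xi> \<bullet> \<xi>)) *\<^sub>R \<xi> - u)"
    unfolding Q by (simp add: scaleR_add_left scaleR_diff_right scaleR_2)
  finally show ?thesis
    by (simp add: transport_dir_def Let_def power2_norm_eq_inner flip: \<xi>_def)
qed

definition bicycle_correspondence ::
    "real \<Rightarrow> (int \<Rightarrow> complex) \<Rightarrow> (int \<Rightarrow> complex) \<Rightarrow> bool" where
  "bicycle_correspondence L V W \<longleftrightarrow>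
     (\<forall>i. dist (V i) (W i) = L \<and> W (i + 1) = transport (V i) (V (i + 1)) (W i))"

text \<open>
  The composition of the transports along the first \<open>k\<close> sides, starting at \<open>V 1\<close>. It is the
  monodromy of a closed \<open>n\<close>-gon for \<open>k = n\<close>, where \<open>V (n + 1) = V 1\<close>.
\<close>

primrec monodromy :: "(int \<Rightarrow> complex) \<Rightarrow> real \<Rightarrow> nat \<Rightarrow> complex \<Rightarrow> complex" where
  "monodromy V L 0 = id"
| "monodromy V L (Suc k) =
     transport_dir (V (int k + 1)) (V (int k + 2)) L \<circ> monodromy V L k"

text \<open>
  The eigenvalue \<open>c\<close> of the differential of a circle map \<open>f\<close> at its fixed point \<open>u\<close>;
  \<open>\<i> * u\<close> spans the tangent line of the circle at \<open>u\<close>. Only the values of \<open>f\<close> on the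
  unit circle are used.
\<close>

definition has_circle_eigenvalue :: "(complex \<Rightarrow> complex) \<Rightarrow> real \<Rightarrow> complex \<Rightarrow> bool" where
  "has_circle_eigenvalue f c u \<longleftrightarrow>
     f u = u \<and> ((\<lambda>t. f (u * cis t)) has_vector_derivative c *\<^sub>R (\<i> * u)) (at 0)"

text \<open>
  The identification of the projective line with the unit circle: the point with homogeneous
  coordinates \<open>(cos (t / 2), sin (t / 2))\<close> corresponds to \<open>cis t\<close>, that is, \<open>tan (t / 2)\<close>
  is the stereographic coordinate.
\<close>

definition circle_point :: "real^2 \<Rightarrow> complex" where
  "circle_point x = Complex (x $ 1) (x $ 2) / cnj (Complex (x $ 1) (x $ 2))"

definition represents_SL2 :: "real^2^2 \<Rightarrow> (complex \<Rightarrow> complex) \<Rightarrow> bool" where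
  "represents_SL2 A f \<longleftrightarrow>
     det A = 1 \<and> (\<forall>x. x \<noteq> 0 \<longrightarrow> f (circle_point x) = circle_point (A *v x))"

text \<open>A representative is unique up to sign. The identity counts as parabolic here.\<close>

definition parabolic :: "(complex \<Rightarrow> complex) \<Rightarrow> bool" where
  "parabolic f \<longleftrightarrow> (\<exists>A. represents_SL2 A f \<and> (trace A = 2 \<or> trace A = - 2))"

text \<open>
  The value \<open>r i\<close> is the signed radius with half-integer index \<open>i + 1/2\<close>. The
  predicate includes the requirement that consecutive lines meet in a single point.
\<close>

definition signed_radii ::
    "(int \<Rightarrow> complex) \<Rightarrow> (int \<Rightarrow> complex) \<Rightarrow> (int \<Rightarrow> real) \<Rightarrow> bool" where
  "signed_radii V W r \<longleftrightarrow>
     (\<forall>i. \<exists>p. affine hull {V i, W i} \<inter> affine hull {V (i + 1), W (i + 1)} = {p} \<and>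
            p = midpoint (V i) (W i) + r i *\<^sub>R sgn (W i - V i))"

end

theory Submission imports Defs begin

text \<open>
  Writing the unit vectors as complex numbers, the transport along a side with vector \<open>D\<close> is
  the fractional-linear map \<open>u \<mapsto> (D - L u) / (cnj D u - L)\<close>. It has the shape
  \<open>w \<mapsto> (a w + b) / (cnj b w + cnj a)\<close> with \<open>a = - L\<close> and \<open>b = D\<close>. Maps of this shape preserve
  the unit circle and are closed under composition, the determinant \<open>|a|\<^sup>2 - |b|\<^sup>2\<close> and the
  denominator being multiplicative (the latter along the orbit, as a cocycle). With respect to
  the angular coordinate such a map has derivative \<open>(|a|\<^sup>2 - |b|\<^sup>2) / |cnj b w + cnj a|\<^sup>2\<close> at \<open>w\<close>
  (\<open>circle_moebius_has_vector_derivative\<close>).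

  For the side from \<open>V i\<close> to \<open>V (i + 1)\<close>, at the direction from \<open>V i\<close> to \<open>W i\<close>, the determinant
  is \<open>L\<^sup>2 - |D|\<^sup>2\<close> and the modulus of the denominator is the diagonal \<open>|V (i + 1) W i|\<close>. Since
  \<open>V i, W i, V (i + 1), W (i + 1)\<close> are the vertices of an isosceles trapezoid, possibly a
  crossed one, with legs of length \<open>L\<close> and with the diagonals \<open>V i W (i + 1)\<close> and
  \<open>V (i + 1) W i\<close> as bases, the product of these diagonals is \<open>||D|\<^sup>2 - L\<^sup>2|\<close>
  (\<open>diagonals_parallel\<close>, \<open>abs_diagonal_ratio\<close>). Hence each step contributes, up to sign, the
  ratio of the two diagonals to the eigenvalue of the monodromy at the fixed point given by \<open>W\<close>.

  The sign and the parabolicity criterion come from a representative in \<open>SL(2, R)\<close>. In the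
  complex coordinate it is again a map of the above shape, of determinant 1. At a fixed point its
  denominator is a real eigenvalue \<open>m\<close> of the matrix, so the derivative is \<open>1 / m\<^sup>2 > 0\<close> while the
  trace is \<open>m + 1 / m\<close>: the trace is \<open>\<plusminus>2\<close> exactly when the derivative is 1
  (\<open>represents_SL2_eigenvalue\<close>).

  Finally, the homothety with centre \<open>P\<close>, the intersection point of the two legs, takes one base
  of the trapezoid to the other, so the ratio of the diagonals is also the ratio
  \<open>|P V i| / |P W i| = |l + r i| / |l - r i|\<close> (\<open>signed_radius_ratio\<close>).
\<close>

section \<open>Fractional-linear maps preserving the unit circle\<close>

definition moebius_denom :: "complex \<Rightarrow> complex \<Rightarrow> complex \<Rightarrow> complex" where
  "moebius_denom a b w = cnj b * w + cnj a"

text \<open>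
  The general form, up to scaling, of a fractional-linear map preserving the unit circle.
  Orientation is preserved for \<open>|a| > |b|\<close> and reversed for \<open>|a| < |b|\<close>.
\<close>
definition circle_moebius :: "complex \<Rightarrow> complex \<Rightarrow> complex \<Rightarrow> complex" where
  "circle_moebius a b w = (a * w + b) / moebius_denom a b w"

lemma moebius_denom_nonzero:
  assumes "norm w = 1" "norm a \<noteq> norm b"
  shows "moebius_denom a b w \<noteq> 0"
proof
  assume "moebius_denom a b w = 0"
  then have "cnj b * w = - cnj a" by (simp add: moebius_denom_def eq_neg_iff_add_eq_0)
  then have "norm (cnj b * w) = norm (- cnj a)" by simp
  then show False using assms by (simp add: norm_mult)
qed

lemma unit_times_cnj: "norm w = 1 \<Longrightarrow> w * cnj w = (1::complex)"
  using complex_norm_square[of w] by simp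

text \<open>
  On the circle the numerator is \<open>w\<close> times the conjugate of the denominator, so that the
  denominator alone determines the value of the map.
\<close>
lemma circle_moebius_by_denom:
  assumes "norm w = 1"
  shows "circle_moebius a b w = w * cnj (moebius_denom a b w) / moebius_denom a b w"
proof -
  have "w * cnj (moebius_denom a b w) = a * w + b * (w * cnj w)"
    by (simp add: moebius_denom_def algebra_simps)
  then show ?thesis by (simp add: circle_moebius_def unit_times_cnj[OF assms])
qed

lemma norm_circle_moebius:
  assumes "norm w = 1" "norm a \<noteq> norm b"
  shows "norm (circle_moebius a b w) = 1"
  using moebius_denom_nonzero[OF assms]
  by (simp add: circle_moebius_by_denom[OF assms(1)] norm_mult norm_divide assms(1))

text \<open>
  The coefficients on the right are those of the product of the matrices with rows
  \<open>(a', b')\<close>, \<open>(cnj b', cnj a')\<close> and \<open>(a, b)\<close>, \<open>(cnj b, cnj a)\<close>. As the product again has this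
  form, no chain rule is needed for compositions: determinants and denominators can be multiplied.
\<close>
lemma moebius_denom_compose:
  assumes "norm w = 1" "norm a \<noteq> norm b"
  shows "moebius_denom a' b' (circle_moebius a b w) * moebius_denom a b w
    = moebius_denom (a' * a + b' * cnj b) (a' * b + b' * cnj a) w"
  using moebius_denom_nonzero[OF assms]
  by (simp add: circle_moebius_def[of a b] moebius_denom_def[of a' b'] distrib_right)
     (simp add: moebius_denom_def algebra_simps)

lemma circle_moebius_compose:
  assumes "norm w = 1" "norm a \<noteq> norm b"
  shows "circle_moebius a' b' (circle_moebius a b w)
    = circle_moebius (a' * a + b' * cnj b) (a' * b + b' * cnj a) w"
proof -
  have nz: "moebius_denom a b w \<noteq> 0" by (rule moebius_denom_nonzero[OF assms])
  have num: "(a' * circle_moebius a b w + b') * moebius_denom a b w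
      = (a' * a + b' * cnj b) * w + (a' * b + b' * cnj a)"
    using nz by (simp add: circle_moebius_def distrib_right)
       (simp add: moebius_denom_def algebra_simps)
  have "circle_moebius a' b' (circle_moebius a b w)
      = ((a' * circle_moebius a b w + b') * moebius_denom a b w)
        / (moebius_denom a' b' (circle_moebius a b w) * moebius_denom a b w)"
    using nz by (simp add: circle_moebius_def[of a' b'])
  then show ?thesis
    by (simp only: num moebius_denom_compose[OF assms] circle_moebius_def[symmetric])
qed

lemma moebius_det_compose:
  "(norm (a' * a + b' * cnj b))\<^sup>2 - (norm (a' * b + b' * cnj a))\<^sup>2
    = ((norm a')\<^sup>2 - (norm b')\<^sup>2) * ((norm a)\<^sup>2 - (norm b)\<^sup>2)"
proof -
  have "complex_of_real ((norm (a' * a + b' * cnj b))\<^sup>2 - (norm (a' * b + b' * cnj a))\<^sup>2)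
    = complex_of_real (((norm a')\<^sup>2 - (norm b')\<^sup>2) * ((norm a)\<^sup>2 - (norm b)\<^sup>2))"
    unfolding of_real_diff of_real_mult complex_norm_square
    by (simp add: algebra_simps)
  then show ?thesis by (simp only: of_real_eq_iff)
qed

text \<open>
  The complex derivative at \<open>u\<close> is \<open>(|a|\<^sup>2 - |b|\<^sup>2) / d\<^sup>2\<close> with \<open>d\<close> the denominator, and the image
  of \<open>u\<close> is \<open>u * cnj d / d\<close>. Dividing out this rotation turns \<open>d\<^sup>2\<close> into \<open>|d|\<^sup>2\<close>.
\<close>
lemma circle_moebius_has_vector_derivative:
  assumes u: "norm u = 1" and ab: "norm a \<noteq> norm b"
  shows "((\<lambda>t. circle_moebius a b (u * cis t)) has_vector_derivative
      (((norm a)\<^sup>2 - (norm b)\<^sup>2) / (norm (moebius_denom a b u))\<^sup>2)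
        *\<^sub>R (\<i> * circle_moebius a b u)) (at 0)"
proof -
  define d where "d = moebius_denom a b u"
  have d: "d \<noteq> 0" using moebius_denom_nonzero[OF u ab] by (simp add: d_def)
  have field: "(circle_moebius a b has_field_derivative (a * cnj a - b * cnj b) / d\<^sup>2) (at u)"
    unfolding circle_moebius_def moebius_denom_def
    using d by (auto intro!: derivative_eq_intros
        simp: d_def moebius_denom_def power2_eq_square algebra_simps)
  have curve: "((\<lambda>t. u * cis t) has_vector_derivative u * \<i>) (at 0)"
    unfolding cis_conv_exp
    by (auto intro!: derivative_eq_intros has_vector_derivative_real_field)
  have "(circle_moebius a b \<circ> (\<lambda>t. u * cis t) has_vector_derivative
      u * \<i> * ((a * cnj a - b * cnj b) / d\<^sup>2)) (at 0)"
    by (rule field_vector_diff_chain_at[OF curve]) (use field in simp)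
  moreover have "u * \<i> * ((a * cnj a - b * cnj b) / d\<^sup>2)
      = (((norm a)\<^sup>2 - (norm b)\<^sup>2) / (norm d)\<^sup>2) *\<^sub>R (\<i> * circle_moebius a b u)"
    unfolding circle_moebius_by_denom[OF u] d_def[symmetric] scaleR_conv_of_real
      of_real_divide of_real_diff complex_norm_square
    using d by (simp add: field_simps power2_eq_square)
  ultimately show ?thesis by (simp add: o_def d_def)
qed

lemma circle_moebius_has_circle_eigenvalue:
  assumes u: "norm u = 1" and ab: "norm a \<noteq> norm b"
    and f: "\<And>w. norm w = 1 \<Longrightarrow> f w = circle_moebius a b w" and fix_u: "f u = u"
  shows "has_circle_eigenvalue f
    (((norm a)\<^sup>2 - (norm b)\<^sup>2) / (norm (moebius_denom a b u))\<^sup>2) u"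
proof -
  have "(\<lambda>t. f (u * cis t)) = (\<lambda>t. circle_moebius a b (u * cis t))"
    using u by (intro ext f) (simp add: norm_mult)
  then show ?thesis
    using circle_moebius_has_vector_derivative[OF u ab] f[OF u] fix_u
    by (simp add: has_circle_eigenvalue_def)
qed

lemma circle_eigenvalue_unique:
  assumes "norm u = 1" "has_circle_eigenvalue f c u" "has_circle_eigenvalue f c' u"
  shows "c = c'"
proof -
  have "c *\<^sub>R (\<i> * u) = c' *\<^sub>R (\<i> * u)"
    using assms(2,3) unfolding has_circle_eigenvalue_def by (blast intro: vector_derivative_unique_at)
  moreover have "\<i> * u \<noteq> 0" using assms(1) by auto
  ultimately show ?thesis by (metis scaleR_right_imp_eq)
qed

section \<open>Representatives in SL(2,R)\<close>

text \<open>
  A real-linear map of the plane is \<open>z \<mapsto> a z + b (cnj z)\<close>, with determinant \<open>|a|\<^sup>2 - |b|\<^sup>2\<close> and trace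
  \<open>2 Re a\<close>. Passing to the circle coordinate \<open>w = z / cnj z\<close> gives the map with the same \<open>a\<close>
  and \<open>b\<close>.
\<close>
lemma represents_SL2_imp_circle_moebius:
  assumes "represents_SL2 A f"
  obtains a b where "(norm a)\<^sup>2 - (norm b)\<^sup>2 = 1" "trace A = 2 * Re a"
    "\<And>w. norm w = 1 \<Longrightarrow> f w = circle_moebius a b w"
proof
  define a where "a = Complex ((A$1$1 + A$2$2) / 2) ((A$2$1 - A$1$2) / 2)"
  define b where "b = Complex ((A$1$1 - A$2$2) / 2) ((A$2$1 + A$1$2) / 2)"
  have det: "det A = 1" and f: "\<And>x. x \<noteq> 0 \<Longrightarrow> f (circle_point x) = circle_point (A *v x)"
    using assms by (auto simp: represents_SL2_def)
  show "(norm a)\<^sup>2 - (norm b)\<^sup>2 = 1"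
    using det unfolding a_def b_def cmod_power2 det_2
    by (simp add: power2_eq_square field_simps)
  show "trace A = 2 * Re a"
    by (simp add: a_def trace_def UNIV_2)
  fix w :: complex assume w: "norm w = 1"
  then obtain t where t: "w = cis t"
    by (metis rcis_cmod_Arg rcis_def mult_1 of_real_1)
  define x :: "real^2" where "x = vector [cos (t / 2), sin (t / 2)]"
  define z where "z = cis (t / 2)"
  have z: "Complex (x $ 1) (x $ 2) = z" by (simp add: x_def z_def complex_eq_iff)
  have "x \<noteq> 0"
  proof
    assume "x = 0"
    then have "z = 0" using z by (simp add: complex_eq_iff)
    then show False by (simp add: z_def)
  qed
  moreover have wz: "w = z / cnj z"
    by (simp add: z_def t cis_cnj cis_divide)
  ultimately have "f w = circle_point (A *v x)" using f[of x] z by (simp add: circle_point_def)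
  also have "Complex ((A *v x) $ 1) ((A *v x) $ 2) = a * z + b * cnj z"
    by (simp add: a_def b_def z[symmetric] matrix_vector_mult_def sum_2 complex_eq_iff field_simps)
  then have "circle_point (A *v x) = (a * z + b * cnj z) / cnj (a * z + b * cnj z)"
    by (simp only: circle_point_def)
  also have "\<dots> = circle_moebius a b w"
  proof -
    have nz: "cnj z \<noteq> 0" by (simp add: z_def)
    have "a * z + b * cnj z = (a * w + b) * cnj z"
      "cnj (a * z + b * cnj z) = moebius_denom a b w * cnj z"
      using nz by (simp_all add: wz moebius_denom_def field_simps)
    then show ?thesis using nz by (simp add: circle_moebius_def)
  qed
  finally show "f w = circle_moebius a b w" .
qed

text \<open>
  At a fixed point the denominator equals its conjugate, so it is a real number \<open>m\<close>. From
  \<open>|m - cnj a| = |b|\<close> it satisfies the characteristic equation \<open>m\<^sup>2 - 2 m (Re a) + 1 = 0\<close>, whose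
  roots are reciprocal.
\<close>
lemma parabolic_trace_iff_norm_denom:
  assumes u: "norm u = 1" and det: "(norm a)\<^sup>2 - (norm b)\<^sup>2 = 1"
    and fix_u: "circle_moebius a b u = u"
  shows "2 * Re a = 2 \<or> 2 * Re a = - 2 \<longleftrightarrow> norm (moebius_denom a b u) = 1"
proof -
  define d where "d = moebius_denom a b u"
  have ne: "norm a \<noteq> norm b" using det by auto
  have d0: "d \<noteq> 0" using moebius_denom_nonzero[OF u ne] by (simp add: d_def)
  have u0: "u \<noteq> 0" using u by auto
  have "cnj d = d"
    using fix_u d0 u0 unfolding circle_moebius_by_denom[OF u] d_def[symmetric]
    by (simp add: field_simps)
  then obtain m where m: "d = of_real m" by (metis Reals_cnj_iff Reals_cases)
  have "(norm (d - cnj a))\<^sup>2 = (norm b)\<^sup>2"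
    by (simp add: d_def moebius_denom_def norm_mult u)
  then have "(m - Re a)\<^sup>2 + (Im a)\<^sup>2 = (norm b)\<^sup>2" by (simp add: m cmod_power2)
  then have char: "m\<^sup>2 - 2 * m * Re a + 1 = 0"
    using det unfolding cmod_power2[of a] by (simp add: power2_eq_square algebra_simps)
  have "Re a = 1 \<or> Re a = - 1 \<longleftrightarrow> \<bar>m\<bar> = 1"
  proof
    assume "Re a = 1 \<or> Re a = - 1"
    then have "(m - 1)\<^sup>2 = 0 \<or> (m + 1)\<^sup>2 = 0"
      using char by (auto simp: power2_eq_square algebra_simps)
    then show "\<bar>m\<bar> = 1" by auto
  next
    assume "\<bar>m\<bar> = 1"
    then have "m = 1 \<or> m = -1" by linarith
    then show "Re a = 1 \<or> Re a = - 1" using char by auto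
  qed
  then show ?thesis by (auto simp: d_def[symmetric] m)
qed

text \<open>
  The derivative at a single known fixed point decides parabolicity, because it is the inverse
  square of one eigenvalue of \<open>A\<close> and the other eigenvalue is reciprocal.
\<close>
lemma represents_SL2_eigenvalue:
  assumes u: "norm u = 1" and A: "represents_SL2 A f" and eig: "has_circle_eigenvalue f c u"
  shows "c > 0" and "trace A = 2 \<or> trace A = - 2 \<longleftrightarrow> c = 1"
proof -
  obtain a b where det: "(norm a)\<^sup>2 - (norm b)\<^sup>2 = 1" and tr: "trace A = 2 * Re a"
    and f: "\<And>w. norm w = 1 \<Longrightarrow> f w = circle_moebius a b w"
    using represents_SL2_imp_circle_moebius[OF A] by blast
  define m where "m = norm (moebius_denom a b u)"
  have ne: "norm a \<noteq> norm b" using det by auto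
  have m: "m > 0" using moebius_denom_nonzero[OF u ne] by (simp add: m_def)
  have fix_u: "f u = u" using eig by (simp add: has_circle_eigenvalue_def)
  have "has_circle_eigenvalue f (1 / m\<^sup>2) u"
    using circle_moebius_has_circle_eigenvalue[OF u ne f fix_u] by (simp add: det m_def)
  then have c: "c = 1 / m\<^sup>2" by (rule circle_eigenvalue_unique[OF u eig])
  show "c > 0" using m by (simp add: c)
  have "c = 1 \<longleftrightarrow> m = 1"
    using m by (simp add: c power2_eq_1_iff)
  then show "trace A = 2 \<or> trace A = - 2 \<longleftrightarrow> c = 1"
    using parabolic_trace_iff_norm_denom[OF u det] f[OF u] fix_u by (simp add: tr m_def)
qed

lemma circle_eigenvalue_pos_of_SL2:
  assumes "norm u = 1" "has_circle_eigenvalue f c u" "\<exists>A. represents_SL2 A f"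
  shows "c > 0"
  using assms represents_SL2_eigenvalue(1) by blast

lemma parabolic_iff_eigenvalue_1:
  assumes "norm u = 1" "has_circle_eigenvalue f c u" "\<exists>A. represents_SL2 A f"
  shows "parabolic f \<longleftrightarrow> c = 1"
  using assms represents_SL2_eigenvalue(2) unfolding parabolic_def by blast

section \<open>Directions of a bicycle pair and its monodromy\<close>

text \<open>
  The reflection of \<open>u\<close> in the line spanned by \<open>\<xi> = D - L u\<close> is \<open>cnj u * \<xi> / cnj \<xi>\<close>, and
  \<open>cnj \<xi> * u = cnj D * u - L\<close> on the unit circle.
\<close>
lemma transport_dir_eq_circle_moebius:
  assumes u: "norm u = 1" and "dist P Q \<noteq> L" "L > 0"
  shows "transport_dir P Q L u = circle_moebius (- of_real L) (Q - P) u"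
proof -
  define \<xi> where "\<xi> = (Q - P) - L *\<^sub>R u"
  have den: "moebius_denom (- of_real L) (Q - P) u = cnj \<xi> * u"
    using unit_times_cnj[OF u]
    by (simp add: \<xi>_def moebius_denom_def scaleR_conv_of_real algebra_simps)
  have \<xi>: "\<xi> \<noteq> 0"
  proof -
    have "norm (L *\<^sub>R u) = L" using assms by simp
    then show ?thesis using assms(2) by (auto simp: \<xi>_def dist_norm norm_minus_commute[of P])
  qed
  have inner: "complex_of_real (2 * (u \<bullet> \<xi>)) = u * cnj \<xi> + cnj u * \<xi>"
    by (simp add: complex_eq_iff inner_complex_def)
  have "transport_dir P Q L u = of_real (2 * (u \<bullet> \<xi>)) / (\<xi> * cnj \<xi>) * \<xi> - u"
    unfolding transport_dir_def Let_def \<xi>_def[symmetric]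
    unfolding scaleR_conv_of_real of_real_divide complex_norm_square ..
  also have "\<dots> = cnj u * \<xi> / cnj \<xi>"
    unfolding inner using \<xi> by (simp add: field_simps)
  also have "\<dots> = circle_moebius (- of_real L) (Q - P) u"
  proof -
    have "u \<noteq> 0" using u by auto
    then show ?thesis
      unfolding circle_moebius_by_denom[OF u] den by (simp add: field_simps)
  qed
  finally show ?thesis .
qed

locale bicycle_pair =
  fixes V W :: "int \<Rightarrow> complex" and L :: real
  assumes L_pos: "L > 0"
    and side: "dist (V i) (V (i + 1)) \<noteq> L"
    and bicycle: "bicycle_correspondence L V W"
begin

definition dir :: "int \<Rightarrow> complex" where
  "dir i = (W i - V i) /\<^sub>R L"

lemma norm_dir: "norm (dir i) = 1"
  using bicycle L_pos
  by (simp add: dir_def bicycle_correspondence_def dist_norm norm_minus_commute)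

lemma W_eq: "W i = V i + L *\<^sub>R dir i"
  using L_pos by (simp add: dir_def)

text \<open>
  If the diagonal vanished, the side would have length \<open>L\<close>. This is where the assumption on the
  side lengths keeps the reflections defining the transport from degenerating.
\<close>
lemma diagonal_nonzero: "V (i + 1) \<noteq> W i"
proof
  assume "V (i + 1) = W i"
  then have "dist (V i) (V (i + 1)) = L"
    using bicycle by (simp add: bicycle_correspondence_def)
  then show False using side by blast
qed

lemma dir_step: "dir (i + 1) = transport_dir (V i) (V (i + 1)) L (dir i)"
proof -
  have "W (i + 1) = V (i + 1) + L *\<^sub>R transport_dir (V i) (V (i + 1)) L (dir i)"
    using transport_eq_transport_dir[of "V (i + 1)" "V i" L "dir i"] bicycle diagonal_nonzero[of i]
    by (simp add: bicycle_correspondence_def W_eq[of i, symmetric])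
  then show ?thesis using L_pos by (simp add: dir_def)
qed

lemma dir_eq_monodromy: "dir (int k + 1) = monodromy V L k (dir 1)"
proof (induction k)
  case (Suc k)
  then show ?case using dir_step[of "int k + 1"] by (simp add: add.commute add.left_commute)
qed simp

lemma norm_step_denom:
  "norm (moebius_denom (- of_real L) (V (i + 1) - V i) (dir i)) = dist (V (i + 1)) (W i)"
proof -
  have "moebius_denom (- of_real L) (V (i + 1) - V i) (dir i) = cnj (V (i + 1) - W i) * dir i"
    using unit_times_cnj[OF norm_dir[of i]]
    by (simp add: W_eq[of i] moebius_denom_def scaleR_conv_of_real algebra_simps)
  then show ?thesis by (simp add: norm_mult norm_dir dist_norm del: complex_cnj_diff)
qed

text \<open>
  Only the denominator at \<open>dir 1\<close> is computed: there the cocycle runs through the successive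
  directions from \<open>V j\<close> to \<open>W j\<close> and collects the diagonals.
\<close>
lemma monodromy_circle_moebius:
  obtains a b where
    "(norm a)\<^sup>2 - (norm b)\<^sup>2 = (\<Prod>j<k. L\<^sup>2 - (dist (V (int j + 1)) (V (int j + 2)))\<^sup>2)"
    "\<And>w. norm w = 1 \<Longrightarrow> monodromy V L k w = circle_moebius a b w"
    "norm (moebius_denom a b (dir 1)) = (\<Prod>j<k. dist (V (int j + 2)) (W (int j + 1)))"
proof (induction k arbitrary: thesis)
  case 0
  show ?case by (rule 0[of 1 0]) (simp_all add: circle_moebius_def moebius_denom_def)
next
  case (Suc k)
  obtain a b where
    det: "(norm a)\<^sup>2 - (norm b)\<^sup>2 = (\<Prod>j<k. L\<^sup>2 - (dist (V (int j + 1)) (V (int j + 2)))\<^sup>2)" and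
    mono: "\<And>w. norm w = 1 \<Longrightarrow> monodromy V L k w = circle_moebius a b w" and
    den: "norm (moebius_denom a b (dir 1)) = (\<Prod>j<k. dist (V (int j + 2)) (W (int j + 1)))"
    using Suc.IH by blast
  have side': "dist (V (int j + 1)) (V (int j + 2)) \<noteq> L" for j
    using side[of "int j + 1"] by (simp add: add.assoc)
  have "L\<^sup>2 - (dist (V (int j + 1)) (V (int j + 2)))\<^sup>2 \<noteq> 0" for j
    using side'[of j] L_pos by (simp add: power2_eq_iff_nonneg)
  then have ne: "norm a \<noteq> norm b" using det by (auto simp: prod_zero_iff)
  define D where "D = V (int k + 2) - V (int k + 1)"
  define a' where "a' = (- of_real L) * a + D * cnj b"
  define b' where "b' = (- of_real L) * b + D * cnj a"
  show ?case
  proof (rule Suc.prems[of a' b'])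
    show "(norm a')\<^sup>2 - (norm b')\<^sup>2
        = (\<Prod>j<Suc k. L\<^sup>2 - (dist (V (int j + 1)) (V (int j + 2)))\<^sup>2)"
      unfolding a'_def b'_def moebius_det_compose det D_def
      by (simp add: dist_norm norm_minus_commute mult.commute)
  next
    fix w :: complex assume w: "norm w = 1"
    have "monodromy V L (Suc k) w
        = transport_dir (V (int k + 1)) (V (int k + 2)) L (circle_moebius a b w)"
      by (simp add: mono[OF w])
    also have "\<dots> = circle_moebius (- of_real L) D (circle_moebius a b w)"
      unfolding D_def
      by (rule transport_dir_eq_circle_moebius[OF norm_circle_moebius[OF w ne] side' L_pos])
    also have "\<dots> = circle_moebius a' b' w"
      unfolding a'_def b'_def by (rule circle_moebius_compose[OF w ne])
    finally show "monodromy V L (Suc k) w = circle_moebius a' b' w" .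
  next
    have "moebius_denom a' b' (dir 1)
        = moebius_denom (- of_real L) D (dir (int k + 1)) * moebius_denom a b (dir 1)"
      unfolding a'_def b'_def
      by (simp only: moebius_denom_compose[OF norm_dir ne, symmetric] dir_eq_monodromy
          mono[OF norm_dir])
    moreover have "norm (moebius_denom (- of_real L) D (dir (int k + 1)))
        = dist (V (int k + 2)) (W (int k + 1))"
      using norm_step_denom[of "int k + 1"] by (simp add: D_def add.assoc)
    ultimately show "norm (moebius_denom a' b' (dir 1))
        = (\<Prod>j<Suc k. dist (V (int j + 2)) (W (int j + 1)))"
      by (simp add: norm_mult den mult.commute)
  qed
qed

section \<open>The trapezoid spanned by two consecutive segments\<close>

text \<open>
  The scaling factor between the two parallel diagonals, by \<open>diagonals_parallel\<close>. It is also minus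
  the angular derivative of the transport along the side at \<open>dir i\<close>.
\<close>
definition diagonal_ratio :: "int \<Rightarrow> real" where
  "diagonal_ratio i =
    ((dist (V i) (V (i + 1)))\<^sup>2 - L\<^sup>2) / (dist (V (i + 1)) (W i))\<^sup>2"

lemma diagonal_ratio_nonzero: "diagonal_ratio i \<noteq> 0"
  using side[of i] diagonal_nonzero[of i] L_pos
  by (simp add: diagonal_ratio_def power2_eq_iff_nonneg)

text \<open>
  With \<open>X = W i\<close> and \<open>U\<close> its translate along the side \<open>P Q\<close>, the parallelogram \<open>P X U Q\<close> has diagonal
  \<open>X Q\<close>. Reflecting \<open>U\<close> in \<open>X Q\<close> makes an isosceles trapezoid from this parallelogram, in which
  \<open>X Q\<close> and the segment from \<open>P\<close> to the image of \<open>U\<close> are parallel.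
\<close>
lemma diagonals_parallel: "W (i + 1) - V i = diagonal_ratio i *\<^sub>R (V (i + 1) - W i)"
proof -
  define D where "D = V (i + 1) - V i"
  define \<xi> where "\<xi> = V (i + 1) - W i"
  define u where "u = dir i"
  have \<xi>: "\<xi> \<noteq> 0" using diagonal_nonzero[of i] by (simp add: \<xi>_def)
  have uu: "u * cnj u = 1" by (simp add: u_def unit_times_cnj norm_dir)
  then have u0: "u \<noteq> 0" by auto
  have D: "D = \<xi> + of_real L * u"
    by (simp add: D_def \<xi>_def u_def W_eq[of i] scaleR_conv_of_real)
  have den: "moebius_denom (- of_real L) D u = cnj \<xi> * u"
    using uu unfolding D by (simp add: moebius_denom_def algebra_simps)
  have v: "dir (i + 1) = cnj u * \<xi> / cnj \<xi>"
  proof -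
    have "dir (i + 1) = circle_moebius (- of_real L) D u"
      unfolding D_def u_def dir_step
      by (rule transport_dir_eq_circle_moebius[OF norm_dir side L_pos])
    then show ?thesis
      using u0 norm_dir[of i] den by (simp add: circle_moebius_by_denom u_def[symmetric])
  qed
  have "W (i + 1) - V i = D + of_real L * (cnj u * \<xi> / cnj \<xi>)"
    by (simp add: W_eq[of "i + 1"] v D_def scaleR_conv_of_real)
  also have "\<dots> = (D * cnj D - (of_real L)\<^sup>2) / (\<xi> * cnj \<xi>) * \<xi>"
    using \<xi> uu unfolding D by (simp add: field_simps power2_eq_square)
  also have "\<dots> = diagonal_ratio i *\<^sub>R \<xi>"
    unfolding scaleR_conv_of_real diagonal_ratio_def of_real_divide of_real_diff dist_norm
      complex_norm_square \<xi>_def[symmetric] norm_minus_commute[of "V i"] D_def[symmetric]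
    by simp
  finally show ?thesis by (simp only: \<xi>_def)
qed

lemma abs_diagonal_ratio:
  "\<bar>diagonal_ratio i\<bar> = dist (V i) (W (i + 1)) / dist (V (i + 1)) (W i)"
proof -
  have "dist (V i) (W (i + 1)) = \<bar>diagonal_ratio i\<bar> * dist (V (i + 1)) (W i)"
    using diagonals_parallel[of i] by (metis dist_norm norm_minus_commute norm_scaleR)
  then show ?thesis using diagonal_nonzero[of i] by simp
qed

text \<open>
  Parallelism of the diagonals says \<open>V i - k W i = W (i + 1) - k V (i + 1)\<close> with
  \<open>k = diagonal_ratio i\<close>. Dividing by \<open>1 - k\<close> exhibits a common point of the two lines.
  By uniqueness it is the centre \<open>p\<close>, which divides the segment from \<open>V i\<close> to \<open>W i\<close>,
  of length \<open>2 l\<close>, in the ratio \<open>(l + r i) : (l - r i)\<close>. Hence this ratio is \<open>- k\<close>.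
\<close>
lemma signed_radius_ratio:
  assumes r: "signed_radii V W r" and l: "L = 2 * l"
  shows "l - r i \<noteq> 0"
    and "\<bar>l + r i\<bar> / \<bar>l - r i\<bar> = dist (V i) (W (i + 1)) / dist (V (i + 1)) (W i)"
proof -
  define k where "k = diagonal_ratio i"
  define line where "line j = affine hull {V j, W j}" for j
  have mem: "x \<in> line j \<longleftrightarrow> (\<exists>s. x = V j + s *\<^sub>R (W j - V j))" for x j
    by (auto simp: line_def affine_hull_2_alt)
  obtain p where p: "line i \<inter> line (i + 1) = {p}"
    and p_eq: "p = midpoint (V i) (W i) + r i *\<^sub>R sgn (W i - V i)"
    using r unfolding signed_radii_def line_def by blast
  have par: "W (i + 1) - V i = k *\<^sub>R (V (i + 1) - W i)"
    unfolding k_def by (rule diagonals_parallel)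
  have norm: "norm (W i - V i) = L"
    using bicycle by (simp add: bicycle_correspondence_def dist_norm norm_minus_commute)
  have WV: "W i - V i \<noteq> 0" using norm L_pos by auto
  have l0: "l > 0" using L_pos l by simp
  have s: "p = V i + ((l + r i) / (2 * l)) *\<^sub>R (W i - V i)"
    using l0 unfolding p_eq sgn_div_norm norm l midpoint_def
    by (simp add: complex_eq_iff field_simps)
  \<comment> \<open>For \<open>k = 1\<close> the lines are parallel, so a common point would not be unique.\<close>
  have k1: "k \<noteq> 1"
  proof
    assume "k = 1"
    with par have WV': "W (i + 1) - V (i + 1) = - (W i - V i)" by (simp add: algebra_simps)
    from p have "p \<in> line i" "p \<in> line (i + 1)" by auto
    then obtain s t where s: "p = V i + s *\<^sub>R (W i - V i)"
      and t: "p = V (i + 1) + t *\<^sub>R (W (i + 1) - V (i + 1))" unfolding mem by blast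
    have "p + (W i - V i) = V i + (s + 1) *\<^sub>R (W i - V i)"
      by (subst s) (simp add: scaleR_add_left)
    moreover have "p + (W i - V i) = V (i + 1) + (t - 1) *\<^sub>R (W (i + 1) - V (i + 1))"
      by (subst t, unfold WV') (simp add: algebra_simps)
    ultimately have "p + (W i - V i) \<in> line i \<inter> line (i + 1)"
      unfolding Int_iff mem by blast
    then have "p + (W i - V i) = p" using p by blast
    then show False using WV by simp
  qed
  define q where "q = V i + (- k / (1 - k)) *\<^sub>R (W i - V i)"
  have scale: "(1 - k) *\<^sub>R x = (1 - k) *\<^sub>R y \<Longrightarrow> x = y" for x y :: complex
    using k1 by simp
  have q': "q = V (i + 1) + (1 / (1 - k)) *\<^sub>R (W (i + 1) - V (i + 1))"
  proof (rule scale)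
    have "(1 - k) *\<^sub>R q = (1 - k) *\<^sub>R V i - k *\<^sub>R (W i - V i)"
      unfolding q_def scaleR_add_right scaleR_scaleR using k1 by simp
    also have "\<dots> = V i - k *\<^sub>R W i" by (simp add: algebra_simps)
    also have "\<dots> = W (i + 1) - k *\<^sub>R V (i + 1)" using par by (simp add: algebra_simps)
    also have "\<dots> = (1 - k) *\<^sub>R V (i + 1) + (W (i + 1) - V (i + 1))" by (simp add: algebra_simps)
    also have "\<dots> = (1 - k) *\<^sub>R (V (i + 1) + (1 / (1 - k)) *\<^sub>R (W (i + 1) - V (i + 1)))"
      using k1 by (simp add: scaleR_add_right)
    finally show "(1 - k) *\<^sub>R q
      = (1 - k) *\<^sub>R (V (i + 1) + (1 / (1 - k)) *\<^sub>R (W (i + 1) - V (i + 1)))" .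
  qed
  have "q \<in> line i \<inter> line (i + 1)" using q_def q' unfolding Int_iff mem by blast
  then have "p = q" unfolding p by simp
  then have "((l + r i) / (2 * l)) *\<^sub>R (W i - V i) = (- k / (1 - k)) *\<^sub>R (W i - V i)"
    using s q_def by simp
  then have sk: "(l + r i) / (2 * l) = - k / (1 - k)" using WV by (metis scaleR_right_imp_eq)
  have k1': "1 - k \<noteq> 0" using k1 by simp
  have sum: "l + r i = 2 * l * (- k / (1 - k))" using l0 sk by (simp add: field_simps)
  have "l - r i = 2 * l - (l + r i)" by simp
  also have "\<dots> = 2 * l / (1 - k)" unfolding sum using k1' by (simp add: field_simps)
  finally have diff: "l - r i = 2 * l / (1 - k)" .
  show "l - r i \<noteq> 0" using diff k1' l0 by simp
  have "(l + r i) / (l - r i) = - k"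
    unfolding sum diff using k1' l0 by (simp add: field_simps)
  then have "\<bar>l + r i\<bar> / \<bar>l - r i\<bar> = \<bar>k\<bar>" by (metis abs_divide abs_minus_cancel)
  then show "\<bar>l + r i\<bar> / \<bar>l - r i\<bar> = dist (V i) (W (i + 1)) / dist (V (i + 1)) (W i)"
    by (simp add: k_def abs_diagonal_ratio)
qed

section \<open>The eigenvalue at the fixed point\<close>

text \<open>
  Each side longer than \<open>L\<close> contributes a negative factor, so the moduli only determine the
  eigenvalue up to sign.
\<close>
lemma monodromy_has_circle_eigenvalue:
  assumes closed: "dir (int n + 1) = dir 1"
  obtains c where "has_circle_eigenvalue (monodromy V L n) c (dir 1)"
    "\<bar>c\<bar> = (\<Prod>j<n. \<bar>diagonal_ratio (int j + 1)\<bar>)"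
proof -
  obtain a b where
    det: "(norm a)\<^sup>2 - (norm b)\<^sup>2 = (\<Prod>j<n. L\<^sup>2 - (dist (V (int j + 1)) (V (int j + 2)))\<^sup>2)" and
    mono: "\<And>w. norm w = 1 \<Longrightarrow> monodromy V L n w = circle_moebius a b w" and
    den: "norm (moebius_denom a b (dir 1)) = (\<Prod>j<n. dist (V (int j + 2)) (W (int j + 1)))"
    using monodromy_circle_moebius by blast
  define c where "c = ((norm a)\<^sup>2 - (norm b)\<^sup>2) / (norm (moebius_denom a b (dir 1)))\<^sup>2"
  have fix_dir: "monodromy V L n (dir 1) = dir 1"
    using dir_eq_monodromy[of n] closed by simp
  have "\<bar>c\<bar> = (\<Prod>j<n. \<bar>L\<^sup>2 - (dist (V (int j + 1)) (V (int j + 2)))\<^sup>2\<bar>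
      / (dist (V (int j + 2)) (W (int j + 1)))\<^sup>2)"
    unfolding c_def det den by (simp add: abs_prod prod_dividef prod_power_distrib)
  also have "\<dots> = (\<Prod>j<n. \<bar>diagonal_ratio (int j + 1)\<bar>)"
    by (rule prod.cong) (simp_all add: diagonal_ratio_def add.assoc abs_minus_commute)
  finally have abs_c: "\<bar>c\<bar> = (\<Prod>j<n. \<bar>diagonal_ratio (int j + 1)\<bar>)" .
  have ne: "norm a \<noteq> norm b"
  proof
    assume "norm a = norm b"
    then have "c = 0" by (simp add: c_def)
    then show False using abs_c diagonal_ratio_nonzero by (auto simp: prod_zero_iff)
  qed
  have "has_circle_eigenvalue (monodromy V L n) c (dir 1)"
    using circle_moebius_has_circle_eigenvalue[of "dir 1" a b "monodromy V L n"]
      ne mono fix_dir norm_dir by (simp add: c_def)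
  then show ?thesis using abs_c that by blast
qed

end

text \<open>
  The monodromy starts at \<open>V 1\<close> and runs over the sides from \<open>j + 1\<close> to \<open>j + 2\<close>, while the product
  in the theorem runs over the sides from \<open>i - 1\<close> to \<open>i\<close>, starting at \<open>V 0\<close>.
\<close>
lemma prod_periodic_shift:
  fixes g :: "int \<Rightarrow> 'a::comm_monoid_mult"
  assumes "\<And>i. g (i + int n) = g i"
  shows "(\<Prod>j<n. g (int j + 1)) = (\<Prod>i = 1..int n. g (i - 1))"
proof -
  have "(\<Prod>j<n. g (int j + 1)) = (\<Prod>j<n. g (int j))"
  proof (cases n)
    case (Suc m)
    have "(\<Prod>j<n. g (int j + 1)) = (\<Prod>j<m. g (int (Suc j))) * g (0 + int n)"
      by (simp add: Suc add.commute)
    also have "\<dots> = (\<Prod>j<m. g (int (Suc j))) * g 0"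
      by (simp only: assms)
    also have "\<dots> = (\<Prod>j<n. g (int j))"
      unfolding Suc prod.lessThan_Suc_shift by (simp add: mult.commute)
    finally show ?thesis .
  qed simp
  also have "\<dots> = (\<Prod>i = 1..int n. g (i - 1))"
    by (rule prod.reindex_bij_witness[where i = "\<lambda>i. nat (i - 1)" and j = "\<lambda>j. int j + 1"]) auto
  finally show ?thesis .
qed

theorem theorem7:
  fixes V W :: "int \<Rightarrow> complex" and n :: nat and l :: real
  assumes "n \<ge> 1" and "l > 0"
    and "closed_polygon n V" and "closed_polygon n W"
    and "\<forall>i. dist (V i) (V (i + 1)) \<noteq> 2 * l"
    and "bicycle_correspondence (2 * l) V W"
    and "\<exists>A. represents_SL2 A (monodromy V (2 * l) n)"
  shows
    "has_circle_eigenvalue (monodromy V (2 * l) n)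
       (\<Prod>i = 1..int n. dist (V (i - 1)) (W i) / dist (V i) (W (i - 1)))
       ((W 1 - V 1) /\<^sub>R (2 * l))
     \<and> (parabolic (monodromy V (2 * l) n) \<longleftrightarrow>
          (\<Prod>i = 1..int n. dist (V (i - 1)) (W i)) = (\<Prod>i = 1..int n. dist (V i) (W (i - 1))))
     \<and> (\<forall>r. signed_radii V W r \<longrightarrow>
          (\<Prod>i = 1..int n. dist (V (i - 1)) (W i) / dist (V i) (W (i - 1)))
            = (\<Prod>i = 0..<int n. \<bar>l + r i\<bar> / \<bar>l - r i\<bar>)
          \<and> (parabolic (monodromy V (2 * l) n) \<longleftrightarrow>
               (\<Prod>i = 0..<int n. \<bar>l + r i\<bar>) = (\<Prod>i = 0..<int n. \<bar>l - r i\<bar>)))"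
proof -
  define L where "L = 2 * l"
  define f where "f = monodromy V L n"
  interpret bicycle_pair V W L
    using assms by unfold_locales (auto simp: L_def)
  have V: "V (i + int n) = V i" and W: "W (i + int n) = W i" for i
    using assms(3,4) by (auto simp: closed_polygon_def)
  define num where "num i = dist (V (i - 1)) (W i)" for i
  define den where "den i = dist (V i) (W (i - 1))" for i
  define c where "c = (\<Prod>i = 1..int n. num i / den i)"
  have den_nz: "den i \<noteq> 0" for i
    using diagonal_nonzero[of "i - 1"] by (simp add: den_def)
  have c_div: "c = (\<Prod>i = 1..int n. num i) / (\<Prod>i = 1..int n. den i)"
    by (simp add: c_def prod_dividef)
  have sl2: "\<exists>A. represents_SL2 A f" using assms(7) by (simp add: f_def L_def)
  have eig: "has_circle_eigenvalue f c (dir 1)"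
  proof -
    have "dir (int n + 1) = dir 1"
      using V[of 1] W[of 1] by (simp add: dir_def add.commute)
    then obtain c' where c': "has_circle_eigenvalue f c' (dir 1)"
      and abs_c': "\<bar>c'\<bar> = (\<Prod>j<n. \<bar>diagonal_ratio (int j + 1)\<bar>)"
      unfolding f_def by (rule monodromy_has_circle_eigenvalue)
    have per: "\<bar>diagonal_ratio (i + int n)\<bar> = \<bar>diagonal_ratio i\<bar>" for i
      using V[of i] V[of "i + 1"] W[of i] by (simp add: diagonal_ratio_def ac_simps)
    have "\<bar>c'\<bar> = (\<Prod>i = 1..int n. \<bar>diagonal_ratio (i - 1)\<bar>)"
      unfolding abs_c' by (rule prod_periodic_shift[where g = "\<lambda>i. \<bar>diagonal_ratio i\<bar>", OF per])
    also have "\<dots> = c" by (simp add: c_def num_def den_def abs_diagonal_ratio)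
    finally show ?thesis
      using c' circle_eigenvalue_pos_of_SL2[OF norm_dir c' sl2] by simp
  qed
  have parabolic: "parabolic f \<longleftrightarrow> c = 1"
    by (rule parabolic_iff_eigenvalue_1[OF norm_dir eig sl2])
  have radii: "c = (\<Prod>i = 0..<int n. \<bar>l + r i\<bar> / \<bar>l - r i\<bar>)
      \<and> (c = 1 \<longleftrightarrow> (\<Prod>i = 0..<int n. \<bar>l + r i\<bar>) = (\<Prod>i = 0..<int n. \<bar>l - r i\<bar>))"
    if r: "signed_radii V W r" for r
  proof -
    have "c = (\<Prod>i = 0..<int n. num (i + 1) / den (i + 1))"
      unfolding c_def
      by (rule prod.reindex_bij_witness[where i = "\<lambda>i. i + 1" and j = "\<lambda>i. i - 1"]) auto
    also have "\<dots> = (\<Prod>i = 0..<int n. \<bar>l + r i\<bar> / \<bar>l - r i\<bar>)"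
      by (simp add: num_def den_def signed_radius_ratio(2)[OF r L_def])
    finally have c: "c = (\<Prod>i = 0..<int n. \<bar>l + r i\<bar> / \<bar>l - r i\<bar>)" .
    have "(\<Prod>i = 0..<int n. \<bar>l - r i\<bar>) \<noteq> 0"
      using signed_radius_ratio(1)[OF r L_def] by (simp add: prod_zero_iff)
    then show ?thesis using c by (auto simp: prod_dividef)
  qed
  have "c = 1 \<longleftrightarrow> (\<Prod>i = 1..int n. num i) = (\<Prod>i = 1..int n. den i)"
    using den_nz by (auto simp: c_div prod_zero_iff)
  then show ?thesis
    using eig[unfolded dir_def] parabolic radii
    unfolding f_def L_def c_def num_def den_def by blast
qed

end
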